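(* For the online max-min fair allocation problem in the adversarial arrival model with $n=2$ agents, the asymptotic competitive ratio of any greedy-type algorithm is at most $\frac{3-\sqrt5}{2}\approx 0.3820$.
   Context: Setting (online max-min fair allocation, adversarial arrival, $n=2$). There are agents $N=\{1,2\}$; a finite, arbitrarily chosen sequence $\sigma$ of items arrives one by one. On arrival of an item $e$ its value vector $(v_1(e),v_2(e))\in[0,1]^2$ is revealed, and $e$ must be irrevocably given to one agent; the number of items is not known in advance. Valuations are additive: $v_i(X)=\sum_{e\in X}v_i(e)$. $\mathrm{ALG}(\sigma)$ is $\min_{i\in N}v_i(A_i)$ for the allocation $(A_1,A_2)$ produced by the algorithm on $\sigma$, and $\mathrm{OPT}(\sigma)$ is the maximum of $\min_{i\in N}v_i(A_i)$ over all allocations (partitions of the items into two parts $A_1,A_2$). A greedy-type algorithm is an algorithm that allocates the next item $e$ to an agent $i$ maximizing $\phi(v_i(A_i\cup\{e\}))-\phi(v_i(A_i))$, where $\phi:\mathbb{R}_+\to\mathbb{R}_+$ is a monotone increasing function (with $\mathbb{R}_+$ the nonnegative reals) and $A_i$ is the set of items which agent $i$ has received so far. The asymptotic competitive ratio of a deterministic algorithm $\mathrm{ALG}$ is $$\liminf_{\mathrm{OPT}(\sigma)\to\infty}\frac{\mathrm{ALG}(\sigma)}{\mathrm{OPT}(\sigma)},$$ i.e. the worst-case ratio over input sequences with sufficiently large optimal value. *)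

theory Defs
  imports "HOL-Analysis.Analysis"
begin

text \<open>
  The type \<open>'n\<close> is the set of agents.  An item is its vector of values, and an input is the list
  of items in order of arrival.  Items are referred to by their arrival positions, so that
  several items with the same value vector remain distinct.
\<close>

type_synonym 'n item = "'n \<Rightarrow> real"

definition valid_item :: "'n item \<Rightarrow> bool" where
  "valid_item e \<longleftrightarrow> (\<forall>i. 0 \<le> e i \<and> e i \<le> 1)"

definition inputs :: "'n item list set" where
  "inputs = {\<sigma>. \<forall>e\<in>set \<sigma>. valid_item e}"

definition val :: "'n item list \<Rightarrow> 'n \<Rightarrow> nat set \<Rightarrow> real" where
  "val \<sigma> i X = (\<Sum>t\<in>X. (\<sigma> ! t) i)"

definition allocations :: "'n item list \<Rightarrow> ('n \<Rightarrow> nat set) set" where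
  "allocations \<sigma> = {A. (\<Union>i. A i) = {..<length \<sigma>} \<and> disjoint_family A}"

definition min_val :: "'n::finite item list \<Rightarrow> ('n \<Rightarrow> nat set) \<Rightarrow> real" where
  "min_val \<sigma> A = Min (range (\<lambda>i. val \<sigma> i (A i)))"

definition OPT :: "'n::finite item list \<Rightarrow> real" where
  "OPT \<sigma> = Max (min_val \<sigma> ` allocations \<sigma>)"

text \<open>
  A deterministic online algorithm maps the nonempty list of items that have arrived so far to
  the agent who receives the last of them.  Earlier decisions are determined by prefixes of this
  list, and the number of future items is not available.
\<close>

type_synonym 'n algorithm = "'n item list \<Rightarrow> 'n"

definition alloc :: "'n algorithm \<Rightarrow> 'n item list \<Rightarrow> 'n \<Rightarrow> nat set" where
  "alloc alg \<sigma> i = {t. t < length \<sigma> \<and> alg (take (Suc t) \<sigma>) = i}"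

definition ALG :: "'n::finite algorithm \<Rightarrow> 'n item list \<Rightarrow> real" where
  "ALG alg \<sigma> = min_val \<sigma> (alloc alg \<sigma>)"

text \<open>
  The gain \<open>\<phi>(v\<^sub>i(A\<^sub>i \<union> {e})) - \<phi>(v\<^sub>i(A\<^sub>i))\<close> when \<open>e\<close> arrives after \<open>\<sigma>\<close>;
  the new item has position \<open>length \<sigma>\<close>.
\<close>

definition gain :: "(real \<Rightarrow> real) \<Rightarrow> 'n algorithm \<Rightarrow> 'n item list \<Rightarrow> 'n item \<Rightarrow> 'n \<Rightarrow> real" where
  "gain \<phi> alg \<sigma> e i =
     \<phi> (val (\<sigma> @ [e]) i (insert (length \<sigma>) (alloc alg \<sigma> i))) - \<phi> (val \<sigma> i (alloc alg \<sigma> i))"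

text \<open>
  Ties may be broken in any way, also depending on the history.  Consequently ``increasing'' has
  to be read strictly: with a constant \<open>\<phi>\<close> all gains are tied, and every algorithm would qualify.
\<close>

definition greedy_type :: "'n algorithm \<Rightarrow> bool" where
  "greedy_type alg \<longleftrightarrow>
     (\<exists>\<phi>. (\<forall>x\<ge>0. \<phi> x \<ge> 0) \<and> strict_mono_on {0..} \<phi> \<and>
       (\<forall>\<sigma>\<in>inputs. \<forall>e. valid_item e \<longrightarrow>
          (\<forall>j. gain \<phi> alg \<sigma> e j \<le> gain \<phi> alg \<sigma> e (alg (\<sigma> @ [e])))))"

text \<open>The filter on inputs describes \<open>OPT \<sigma> \<longlonglongrightarrow> \<infinity>\<close>.\<close>

definition asymptotic_competitive_ratio :: "'n::finite algorithm \<Rightarrow> ereal" where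
  "asymptotic_competitive_ratio alg =
     Liminf (inf (filtercomap OPT at_top) (principal inputs)) (\<lambda>\<sigma>. ereal (ALG alg \<sigma> / OPT \<sigma>))"

lemma finite_allocations: "finite (allocations (\<sigma> :: 'n::finite item list))"
proof (rule finite_subset)
  show "allocations \<sigma> \<subseteq> (UNIV :: 'n set) \<rightarrow>\<^sub>E Pow {..<length \<sigma>}"
    by (auto simp: allocations_def PiE_def)
  show "finite ((UNIV :: 'n set) \<rightarrow>\<^sub>E Pow {..<length \<sigma>})"
    by (intro finite_PiE) auto
qed

lemma alloc_in_allocations: "alloc alg \<sigma> \<in> allocations \<sigma>"
  by (auto simp: allocations_def alloc_def disjoint_family_on_def)

end

theory Submission
  imports Defs
begin

text \<open>
  Every greedy-type algorithm even has asymptotic ratio \<open>0\<close>.  Call a step \<open>[p, q]\<close> of length at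
  most \<open>1\<close> good if \<open>\<phi> q - \<phi> p \<ge> g\<close>, and let \<open>N k\<close> be the largest number of nonoverlapping good
  steps in \<open>[T, 2 * T]\<close> where \<open>T = 2 ^ k * t\<close> and \<open>k < R\<close>.  Take \<open>k\<close> with \<open>N k\<close> minimal and cut
  \<open>[T, 2 * T]\<close> into \<open>N k + 1\<close> pieces of equal length \<open>x\<close>, where \<open>x \<le> 1\<close> if \<open>g\<close> is small.
  As \<open>N k\<close> is maximal, some piece \<open>[a, a + x]\<close> is not good.
  Park one agent at the value \<open>a\<close> and lead the other one through all the good steps \<open>[p, q]\<close> with
  items of values \<open>x\<close> and \<open>q - p\<close>: the parked agent, whose gain is smaller than \<open>g\<close>, loses all of
  them, in total at least \<open>R * N k * x \<ge> R * T / 2\<close>, while it has \<open>a \<le> 2 * T\<close>.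
\<close>

section \<open>Chains of good steps\<close>

text \<open>Steps have length at most 1 so that one item can realise each of them. Gaps are allowed
  before, between and after steps, so chains over adjacent intervals concatenate.\<close>

inductive chain :: "(real \<Rightarrow> real) \<Rightarrow> real \<Rightarrow> real \<Rightarrow> nat \<Rightarrow> real \<Rightarrow> bool"
  for \<phi> :: "real \<Rightarrow> real" and g :: real where
  nil: "u \<le> v \<Longrightarrow> chain \<phi> g u 0 v"
| step: "u \<le> p \<Longrightarrow> p \<le> q \<Longrightarrow> q \<le> p + 1 \<Longrightarrow> g \<le> \<phi> q - \<phi> p \<Longrightarrow> chain \<phi> g q n v
    \<Longrightarrow> chain \<phi> g u (Suc n) v"

lemma chain_mono_left: "chain \<phi> g v n w \<Longrightarrow> u \<le> v \<Longrightarrow> chain \<phi> g u n w"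
proof (induction arbitrary: u rule: chain.induct)
  case (step v p q n w)
  have "u \<le> p" using step by simp
  from chain.step[OF this step(2-5)] show ?case .
qed (simp add: chain.nil)

lemma chain_append: "chain \<phi> g u m v \<Longrightarrow> chain \<phi> g v n w \<Longrightarrow> chain \<phi> g u (m + n) w"
proof (induction rule: chain.induct)
  case (nil u v)
  then show ?case by (simp add: chain_mono_left)
next
  case (step u p q n v)
  then show ?case using chain.step[of u p q g \<phi> "n + _"] by simp
qed

lemma chain_sum:
  assumes "\<And>k. k < R \<Longrightarrow> chain \<phi> g (T k) (N k) (T (Suc k))"
  shows "chain \<phi> g (T 0) (\<Sum>k<R. N k) (T R)"
  using assms
proof (induction R)
  case 0
  then show ?case by (simp add: chain.nil)
next
  case (Suc R)
  then show ?case using chain_append[of \<phi> g "T 0" "\<Sum>k<R. N k" "T R" "N R" "T (Suc R)"] by simp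
qed

text \<open>Serves twice: unit steps bound the maximal chain length from below, and the
  \<open>N k + 1\<close> equal pieces give the contradiction with maximality.\<close>

lemma chain_equal_steps:
  assumes "0 \<le> x" "x \<le> 1"
    and "\<And>i. i < n \<Longrightarrow> g \<le> \<phi> (u + real (Suc i) * x) - \<phi> (u + real i * x)"
  shows "chain \<phi> g u n (u + real n * x)"
  using assms(3)
proof (induction n)
  case 0
  then show ?case by (simp add: chain.nil)
next
  case (Suc n)
  have "chain \<phi> g (u + real n * x) (Suc 0) (u + real (Suc n) * x)"
    by (rule chain.step[of _ "u + real n * x" "u + real (Suc n) * x"])
      (use Suc.prems[of n] assms in \<open>auto intro: chain.nil simp: algebra_simps\<close>)
  from chain_append[OF _ this] Suc show ?case by simp
qed

text \<open>The differences of \<open>\<phi>\<close> over the steps telescope, since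
  \<open>\<phi>\<close> does not fall across the gaps. With \<open>g > 0\<close> this bounds the
  chain length.\<close>

lemma chain_bound:
  assumes "chain \<phi> g u n v" and "0 \<le> u" and "mono_on {0..} \<phi>"
  shows "real n * g \<le> \<phi> v - \<phi> u"
  using assms(1,2)
proof (induction rule: chain.induct)
  case (nil u v)
  then show ?case using assms(3) by (auto simp: mono_on_def)
next
  case (step u p q n v)
  moreover have "\<phi> u \<le> \<phi> p" using assms(3) step by (auto simp: mono_on_def)
  ultimately show ?case by (auto simp: algebra_simps)
qed

lemma longest_chain:
  assumes "0 \<le> u" "mono_on {0..} \<phi>" "0 < g" "chain \<phi> g u m v"
  obtains N where "chain \<phi> g u N v" "m \<le> N" "\<And>n. chain \<phi> g u n v \<Longrightarrow> n \<le> N"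
proof -
  have bound: "n \<le> nat \<lceil>(\<phi> v - \<phi> u) / g\<rceil>" if "chain \<phi> g u n v" for n
  proof -
    have "real n \<le> (\<phi> v - \<phi> u) / g"
      using chain_bound[OF that assms(1,2)] assms(3) by (simp add: field_simps)
    then show ?thesis by linarith
  qed
  let ?P = "\<lambda>n. chain \<phi> g u n v"
  show ?thesis
  proof (rule that)
    show "?P (Greatest ?P)" by (rule GreatestI_nat[of ?P, OF assms(4) bound])
    show "m \<le> Greatest ?P" by (rule Greatest_le_nat[of ?P, OF assms(4) bound])
    show "n \<le> Greatest ?P" if "?P n" for n by (rule Greatest_le_nat[of ?P, OF that bound])
  qed
qed

section \<open>Steering a greedy-type algorithm\<close>

definition received :: "'n algorithm \<Rightarrow> 'n item list \<Rightarrow> 'n \<Rightarrow> real" where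
  "received alg \<sigma> i = val \<sigma> i (alloc alg \<sigma> i)"

lemma val_append: "X \<subseteq> {..<length \<sigma>} \<Longrightarrow> val (\<sigma> @ \<tau>) i X = val \<sigma> i X"
  unfolding val_def by (rule sum.cong) (auto simp: nth_append)

lemma alloc_subset: "alloc alg \<sigma> i \<subseteq> {..<length \<sigma>}"
  by (auto simp: alloc_def)

lemma alloc_snoc:
  "alloc alg (\<sigma> @ [e]) i =
     (if alg (\<sigma> @ [e]) = i then insert (length \<sigma>) (alloc alg \<sigma> i) else alloc alg \<sigma> i)"
  by (auto simp: alloc_def less_Suc_eq)

lemma val_snoc_insert:
  "val (\<sigma> @ [e]) i (insert (length \<sigma>) (alloc alg \<sigma> i)) = received alg \<sigma> i + e i"
proof -
  have "finite (alloc alg \<sigma> i)" "length \<sigma> \<notin> alloc alg \<sigma> i"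
    by (auto simp: alloc_def)
  then have "val (\<sigma> @ [e]) i (insert (length \<sigma>) (alloc alg \<sigma> i))
      = e i + val (\<sigma> @ [e]) i (alloc alg \<sigma> i)"
    by (simp add: val_def)
  then show ?thesis by (simp add: received_def val_append alloc_subset)
qed

lemma received_snoc:
  "received alg (\<sigma> @ [e]) i = received alg \<sigma> i + (if alg (\<sigma> @ [e]) = i then e i else 0)"
proof (cases "alg (\<sigma> @ [e]) = i")
  case True
  then show ?thesis using val_snoc_insert[of \<sigma> e i alg]
    by (simp add: received_def alloc_snoc)
next
  case False
  then show ?thesis by (simp add: received_def alloc_snoc val_append alloc_subset)
qed

lemma received_nil: "received alg [] i = 0"
  by (simp add: received_def val_def alloc_def)

lemma received_nonneg: "\<sigma> \<in> inputs \<Longrightarrow> 0 \<le> received alg \<sigma> i"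
  unfolding received_def val_def inputs_def valid_item_def alloc_def
  by (auto intro!: sum_nonneg)

lemma gain_eq: "gain \<phi> alg \<sigma> e i = \<phi> (received alg \<sigma> i + e i) - \<phi> (received alg \<sigma> i)"
  by (simp add: gain_def val_snoc_insert received_def[symmetric])

section \<open>Total values and a lower bound for the optimum\<close>

definition total_value :: "'n item list \<Rightarrow> 'n \<Rightarrow> real" where
  "total_value \<sigma> i = (\<Sum>e\<leftarrow>\<sigma>. e i)"

lemma total_value_append: "total_value (\<sigma> @ \<tau>) i = total_value \<sigma> i + total_value \<tau> i"
  by (simp add: total_value_def)

lemma total_value_nonneg: "\<sigma> \<in> inputs \<Longrightarrow> 0 \<le> total_value \<sigma> i"
  by (auto simp: total_value_def inputs_def valid_item_def intro!: sum_list_nonneg)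

lemma val_total: "val \<sigma> i {..<length \<sigma>} = total_value \<sigma> i"
  by (simp add: val_def total_value_def sum_list_sum_nth atLeast0LessThan)

lemma append_inputs: "\<sigma> @ \<tau> \<in> inputs \<longleftrightarrow> \<sigma> \<in> inputs \<and> \<tau> \<in> inputs"
  by (auto simp: inputs_def)

text \<open>The agents are called 0 and 1 from here on; in the type \<open>2\<close> the numeral 2
  equals 0. Agent 0 will be the parked one.\<close>

lemma UNIV_2_eq: "(UNIV :: 2 set) = {0, 1}"
proof -
  have "(2 :: 2) = 0" by simp
  then show ?thesis by (auto simp: UNIV_2)
qed

lemma min_val_2: "min_val \<sigma> A = min (val \<sigma> (0::2) (A 0)) (val \<sigma> 1 (A 1))"
  by (simp add: min_val_def UNIV_2_eq)

text \<open>One candidate allocation gives all of \<open>\<sigma>\<close> to agent 0 and all of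
  \<open>\<tau>\<close> to agent 1.\<close>

lemma OPT_append_ge:
  fixes \<sigma> \<tau> :: "2 item list"
  shows "min (total_value \<sigma> 0) (total_value \<tau> 1) \<le> OPT (\<sigma> @ \<tau>)"
proof -
  define A :: "2 \<Rightarrow> nat set" where
    "A i = (if i = 0 then {..<length \<sigma>} else {length \<sigma>..<length (\<sigma> @ \<tau>)})" for i
  have "A \<in> allocations (\<sigma> @ \<tau>)"
    by (auto simp: allocations_def A_def UNIV_2_eq disjoint_family_on_def)
  then have "min_val (\<sigma> @ \<tau>) A \<le> OPT (\<sigma> @ \<tau>)"
    by (auto simp: OPT_def finite_allocations)
  moreover have "val (\<sigma> @ \<tau>) 0 (A 0) = total_value \<sigma> 0"
    by (simp add: A_def val_append val_total)
  moreover have "val (\<sigma> @ \<tau>) 1 (A 1) = total_value \<tau> 1"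
  proof -
    have "{length \<sigma>..<length \<sigma> + length \<tau>} = (\<lambda>t. t + length \<sigma>) ` {..<length \<tau>}"
      by (simp add: lessThan_atLeast0 add.commute)
    then have "val (\<sigma> @ \<tau>) 1 (A 1) = val \<tau> 1 {..<length \<tau>}"
      by (simp add: A_def val_def sum.reindex nth_append)
    then show ?thesis by (simp add: val_total)
  qed
  ultimately show ?thesis by (simp add: min_val_2)
qed

section \<open>Forcing the decisions of a greedy-type algorithm\<close>

locale greedy_2 =
  fixes alg :: "2 algorithm" and \<phi> :: "real \<Rightarrow> real"
  assumes strict: "strict_mono_on {0..} \<phi>"
    and greedy: "\<And>\<sigma> e j. \<sigma> \<in> inputs \<Longrightarrow> valid_item e
      \<Longrightarrow> gain \<phi> alg \<sigma> e j \<le> gain \<phi> alg \<sigma> e (alg (\<sigma> @ [e]))"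
begin

lemma mono: "mono_on {0..} \<phi>"
  using strict by (rule strict_mono_on_imp_mono_on)

text \<open>A strictly larger gain forces the decision whatever the tie-breaking.\<close>

lemma chooses:
  assumes "\<sigma> \<in> inputs" "valid_item e"
    and "\<And>i. i \<noteq> j \<Longrightarrow> \<phi> (received alg \<sigma> i + e i) - \<phi> (received alg \<sigma> i)
      < \<phi> (received alg \<sigma> j + e j) - \<phi> (received alg \<sigma> j)"
  shows "alg (\<sigma> @ [e]) = j"
proof (rule ccontr)
  assume "alg (\<sigma> @ [e]) \<noteq> j"
  from assms(3)[OF this] greedy[OF assms(1,2), of j] show False by (simp add: gain_eq)
qed

text \<open>The other agent's gain is 0, while strict monotonicity makes the gain of
  \<open>j\<close> positive.\<close>

lemma feed_step:
  fixes j :: 2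
  assumes "\<sigma> \<in> inputs" "0 < y" "y \<le> 1"
  defines "e \<equiv> (\<lambda>i. if i = j then y else 0)"
  shows "valid_item e" "alg (\<sigma> @ [e]) = j"
proof -
  show "valid_item e" using assms by (simp add: valid_item_def)
  then show "alg (\<sigma> @ [e]) = j"
    by (rule chooses[OF assms(1)])
      (use assms received_nonneg[OF assms(1), where alg = alg and i = j] in
        \<open>auto intro: strict_mono_onD[OF strict]\<close>)
qed

lemma feed:
  assumes "\<sigma> \<in> inputs" "0 \<le> y"
  obtains \<tau> where "\<tau> \<in> inputs" "total_value \<tau> j = y"
    "received alg (\<sigma> @ \<tau>) = (received alg \<sigma>)(j := received alg \<sigma> j + y)"
proof -
  have "\<exists>\<tau>\<in>inputs. total_value \<tau> j = y \<and>
      received alg (\<sigma> @ \<tau>) = (received alg \<sigma>)(j := received alg \<sigma> j + y)"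
    if "y \<le> real n" for n
    using that assms
  proof (induction n arbitrary: y \<sigma>)
    case 0
    then show ?case by (intro bexI[of _ "[]"]) (auto simp: total_value_def inputs_def)
  next
    case (Suc n)
    show ?case
    proof (cases "y = 0")
      case True
      then show ?thesis by (intro bexI[of _ "[]"]) (auto simp: total_value_def inputs_def)
    next
      case False
      \<comment> \<open>As much of \<open>y\<close> as a single item may carry; the remainder is at
        most \<open>n\<close>.\<close>
      define z where "z = min y 1"
      define e where "e = (\<lambda>i. if i = j then z else 0)"
      have z: "0 < z" "z \<le> 1" "z \<le> y" "y - z \<le> real n"
        using False Suc.prems by (auto simp: z_def)
      have e: "valid_item e" "alg (\<sigma> @ [e]) = j"
        unfolding e_def using feed_step[OF Suc.prems(2) z(1,2)] by auto
      have "\<sigma> @ [e] \<in> inputs" using e Suc.prems by (auto simp: inputs_def)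
      then obtain \<tau> where \<tau>: "\<tau> \<in> inputs" "total_value \<tau> j = y - z"
        "received alg ((\<sigma> @ [e]) @ \<tau>) =
          (received alg (\<sigma> @ [e]))(j := received alg (\<sigma> @ [e]) j + (y - z))"
        using Suc.IH[of "y - z" "\<sigma> @ [e]"] z by (metis diff_ge_0_iff_ge)
      have "received alg (\<sigma> @ [e]) = (received alg \<sigma>)(j := received alg \<sigma> j + z)"
        using e by (auto simp: received_snoc e_def)
      then have "received alg (\<sigma> @ e # \<tau>) = (received alg \<sigma>)(j := received alg \<sigma> j + y)"
        using \<tau>(3) by simp
      then show ?thesis
        using e \<tau> by (intro bexI[of _ "e # \<tau>"]) (auto simp: total_value_def inputs_def e_def)
    qed
  qed
  moreover obtain n where "y \<le> real n" using real_arch_simple by blast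
  ultimately show ?thesis using that by blast
qed

text \<open>At each step agent 1 gains at least \<open>g\<close> and agent 0 would gain less than
  \<open>g\<close>, so agent 1 takes every such item and agent 0 misses value \<open>x\<close> each
  time.\<close>

lemma follow_chain:
  assumes "chain \<phi> g u n v" "\<sigma> \<in> inputs"
    and "received alg \<sigma> 1 \<le> u" "received alg \<sigma> 0 = a"
    and x: "0 \<le> x" "x \<le> 1" "\<phi> (a + x) - \<phi> a < g"
  shows "\<exists>\<tau>\<in>inputs. received alg (\<sigma> @ \<tau>) 0 = a \<and> total_value \<tau> 0 \<ge> real n * x"
  using assms(1-4)
proof (induction arbitrary: \<sigma> rule: chain.induct)
  case (nil u v)
  then show ?case by (intro bexI[of _ "[]"]) (auto simp: total_value_def inputs_def)
next
  case (step u p q n v)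
  \<comment> \<open>Agent 1 is lifted across the gap to exactly \<open>p\<close>, because the bound
    \<open>g\<close> is known only for the step starting there.\<close>
  obtain \<rho> where \<rho>: "\<rho> \<in> inputs" and rec\<rho>: "received alg (\<sigma> @ \<rho>) =
      (received alg \<sigma>)(1 := received alg \<sigma> 1 + (p - received alg \<sigma> 1))"
    using feed[OF step.prems(1), of "p - received alg \<sigma> 1" 1] step by auto
  have r: "received alg (\<sigma> @ \<rho>) 1 = p" "received alg (\<sigma> @ \<rho>) 0 = a"
    using rec\<rho> step.prems(3) by auto
  define e :: "2 item" where "e = (\<lambda>i. if i = 1 then q - p else x)"
  have e: "valid_item e" using step.hyps x by (auto simp: valid_item_def e_def)
  have in1: "\<sigma> @ \<rho> \<in> inputs" using \<rho> step.prems(1) by (simp add: append_inputs)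
  have alg1: "alg ((\<sigma> @ \<rho>) @ [e]) = 1"
  proof (rule chooses[OF in1 e])
    fix i :: 2 assume "i \<noteq> 1"
    then have "i = 0" using UNIV_2_eq by auto
    then show "\<phi> (received alg (\<sigma> @ \<rho>) i + e i) - \<phi> (received alg (\<sigma> @ \<rho>) i)
      < \<phi> (received alg (\<sigma> @ \<rho>) 1 + e 1) - \<phi> (received alg (\<sigma> @ \<rho>) 1)"
      using step.hyps x unfolding r \<open>i = 0\<close> by (simp add: e_def r)
  qed
  have in2: "(\<sigma> @ \<rho>) @ [e] \<in> inputs" using in1 e by (auto simp: inputs_def)
  have "received alg ((\<sigma> @ \<rho>) @ [e]) 1 \<le> q" "received alg ((\<sigma> @ \<rho>) @ [e]) 0 = a"
    unfolding received_snoc alg1 r by (auto simp: e_def)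
  from step.IH[OF in2 this] obtain \<tau> where \<tau>: "\<tau> \<in> inputs"
    "received alg (((\<sigma> @ \<rho>) @ [e]) @ \<tau>) 0 = a" "total_value \<tau> 0 \<ge> real n * x" by blast
  show ?case
  proof (intro bexI[of _ "\<rho> @ [e] @ \<tau>"] conjI)
    show "received alg (\<sigma> @ \<rho> @ [e] @ \<tau>) 0 = a" using \<tau>(2) by simp
    have "total_value [e] 0 = x" by (simp add: total_value_def e_def)
    then show "total_value (\<rho> @ [e] @ \<tau>) 0 \<ge> real (Suc n) * x"
      unfolding total_value_append using \<tau>(3) total_value_nonneg[OF \<rho>, of 0] by (simp add: algebra_simps)
    show "\<rho> @ [e] @ \<tau> \<in> inputs" using \<rho> e \<tau> by (auto simp: inputs_def)
  qed
qed

text \<open>Three phases: \<open>\<rho>\<close> lifts agent 0 to \<open>a\<close>,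
  \<open>\<tau>\<close> follows the chain, and \<open>\<omega>\<close> feeds agent 1 alone. A good
  allocation gives the first two phases to agent 0 and the last one to agent 1.\<close>

lemma parked_agent:
  assumes "chain \<phi> g 0 n v" "0 \<le> a"
    and x: "0 \<le> x" "x \<le> 1" "\<phi> (a + x) - \<phi> a < g"
  obtains \<sigma> where "\<sigma> \<in> inputs" "ALG alg \<sigma> \<le> a" "real n * x \<le> OPT \<sigma>"
proof -
  have "[] \<in> inputs" by (simp add: inputs_def)
  from feed[OF this assms(2), of 0] obtain \<rho> where \<rho>: "\<rho> \<in> inputs" and
    "received alg ([] @ \<rho>) = (received alg [])(0 := received alg [] 0 + a)" by blast
  then have "received alg \<rho> 1 \<le> 0" "received alg \<rho> 0 = a" by (auto simp: received_nil)
  from follow_chain[OF assms(1) \<rho> this x] obtain \<tau> where \<tau>: "\<tau> \<in> inputs"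
    "received alg (\<rho> @ \<tau>) 0 = a" "total_value \<tau> 0 \<ge> real n * x" by blast
  have in1: "\<rho> @ \<tau> \<in> inputs" using \<rho> \<tau> by (simp add: append_inputs)
  have "0 \<le> real n * x" using x by simp
  from feed[OF in1 this, of 1] obtain \<omega> where \<omega>: "\<omega> \<in> inputs" "total_value \<omega> 1 = real n * x"
    "received alg ((\<rho> @ \<tau>) @ \<omega>) =
      (received alg (\<rho> @ \<tau>))(1 := received alg (\<rho> @ \<tau>) 1 + real n * x)" by blast
  show ?thesis
  proof (rule that)
    show "(\<rho> @ \<tau>) @ \<omega> \<in> inputs" using in1 \<omega> by (simp add: append_inputs)
    have "received alg ((\<rho> @ \<tau>) @ \<omega>) 0 = a" unfolding \<omega>(3) using \<tau>(2) by simp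
    then show "ALG alg ((\<rho> @ \<tau>) @ \<omega>) \<le> a" unfolding ALG_def min_val_2 received_def by linarith
    have "real n * x \<le> total_value (\<rho> @ \<tau>) 0"
      using \<tau>(3) total_value_nonneg[OF \<rho>, of 0] by (simp add: total_value_append)
    then show "real n * x \<le> OPT ((\<rho> @ \<tau>) @ \<omega>)"
      using OPT_append_ge[of "\<rho> @ \<tau>" \<omega>] \<omega>(2) by simp
  qed
qed

text \<open>\<open>R\<close>, the number of dyadic scales, controls the ratio; \<open>t\<close>, the
  smallest scale, makes the optimum large.\<close>

lemma bad_input:
  fixes R t :: nat
  assumes "0 < R" "0 < t"
  obtains \<sigma> where "\<sigma> \<in> inputs" "real (R * t) / 2 \<le> OPT \<sigma>" "ALG alg \<sigma> / OPT \<sigma> \<le> 4 / real R"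
proof -
  define T where "T k = 2 ^ k * t" for k :: nat
  have T_pos: "0 < T k" "t \<le> T k" for k using assms by (auto simp: T_def)
  have T_Suc: "T (Suc k) = T k + T k" for k by (simp add: T_def)
  have T_mono: "T k \<le> T l" if "k \<le> l" for k l using that by (simp add: T_def)
  \<comment> \<open>With \<open>g\<close> the least increase over the unit steps up to
    \<open>T R\<close>, all of these steps are good. Hence \<open>N k \<ge> T k\<close>, which later
    gives \<open>x \<le> 1\<close>.\<close>
  define D where "D = (\<lambda>i::nat. \<phi> (real (Suc i)) - \<phi> (real i)) ` {..<T R}"
  define g where "g = Min D"
  have D: "finite D" "D \<noteq> {}" using T_pos(1)[of R] by (auto simp: D_def)
  have "0 < d" if "d \<in> D" for d
    using that by (auto simp: D_def intro!: strict_mono_onD[OF strict])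
  then have g: "0 < g" using D by (simp add: g_def)
  have g_le: "g \<le> \<phi> (real (Suc i)) - \<phi> (real i)" if "i < T R" for i
    unfolding g_def by (rule Min_le) (use that in \<open>auto simp: D_def\<close>)
  have "\<exists>N. chain \<phi> g (T k) N (T (Suc k)) \<and> T k \<le> N \<and>
      (\<forall>n. chain \<phi> g (T k) n (T (Suc k)) \<longrightarrow> n \<le> N)" if "k < R" for k
  proof -
    have "chain \<phi> g (T k) (T k) (real (T k) + real (T k) * 1)"
    proof (rule chain_equal_steps)
      fix i assume "i < T k"
      then have "T k + i < T R" using T_mono[of "Suc k" R] that T_Suc[of k] by simp
      from g_le[OF this]
      show "g \<le> \<phi> (real (T k) + real (Suc i) * 1) - \<phi> (real (T k) + real i * 1)"
        by (simp add: algebra_simps)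
    qed auto
    then have "chain \<phi> g (T k) (T k) (T (Suc k))" by (simp add: T_Suc)
    then show ?thesis using longest_chain[OF _ mono g, of "T k"] by (metis of_nat_0_le_iff)
  qed
  then obtain N where N: "\<And>k. k < R \<Longrightarrow> chain \<phi> g (T k) (N k) (T (Suc k))"
    "\<And>k. k < R \<Longrightarrow> T k \<le> N k"
    "\<And>k n. k < R \<Longrightarrow> chain \<phi> g (T k) n (T (Suc k)) \<Longrightarrow> n \<le> N k"
    by metis
  define n where "n = (\<Sum>k<R. N k)"
  have "chain \<phi> g (T 0) n (T R)"
    unfolding n_def by (rule chain_sum) (use N in auto)
  then have chain_n: "chain \<phi> g 0 n (T R)" by (rule chain_mono_left) simp
  \<comment> \<open>Minimality of \<open>N k\<close> makes the concatenated chain at least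
    \<open>R * N k\<close> steps long.\<close>
  define k where "k = arg_min_on N {..<R}"
  have k: "k < R" "\<And>l. l < R \<Longrightarrow> N k \<le> N l"
    using arg_min_if_finite(1)[of "{..<R}" N] arg_min_least[of "{..<R}" _ N] assms(1)
    by (auto simp: k_def)
  have "R * N k \<le> n"
    using sum_bounded_below[of "{..<R}" "N k" N] k by (simp add: n_def)
  then have Rn: "real R * real (N k) \<le> real n" by (metis of_nat_le_iff of_nat_mult)
  \<comment> \<open>One piece more than the longest chain in \<open>[T k, 2 * T k]\<close> has
    steps, so not every piece can be good.\<close>
  define x where "x = real (T k) / real (Suc (N k))"
  have x: "0 < x" "x \<le> 1" "real (Suc (N k)) * x = T k"
    using N(2)[OF k(1)] T_pos[of k] by (auto simp: x_def field_simps)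
  have "\<exists>i<Suc (N k). \<phi> (T k + real (Suc i) * x) - \<phi> (T k + real i * x) < g"
  proof (rule ccontr)
    assume "\<not> ?thesis"
    then have "chain \<phi> g (T k) (Suc (N k)) (T k + real (Suc (N k)) * x)"
      by (intro chain_equal_steps) (use x in \<open>auto simp del: of_nat_Suc simp flip: not_less\<close>)
    then have "chain \<phi> g (T k) (Suc (N k)) (T (Suc k))" by (simp only: x(3) T_Suc of_nat_add)
    from N(3)[OF k(1) this] show False by simp
  qed
  then obtain i where i: "i < Suc (N k)"
    "\<phi> (T k + real (Suc i) * x) - \<phi> (T k + real i * x) < g" by blast
  define a where "a = T k + real i * x"
  have "real i * x \<le> real (Suc (N k)) * x" using i(1) x(1) by (intro mult_right_mono) auto
  then have a: "0 \<le> a" "a \<le> 2 * T k" using x(1) unfolding x(3) by (auto simp: a_def)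
  have "\<phi> (a + x) - \<phi> a < g" using i(2) by (simp add: a_def algebra_simps)
  then obtain \<sigma> where \<sigma>: "\<sigma> \<in> inputs" "ALG alg \<sigma> \<le> a" "real n * x \<le> OPT \<sigma>"
    using parked_agent[OF chain_n a(1) _ x(2)] x(1) by (metis less_imp_le)
  \<comment> \<open>Replacing \<open>N k + 1\<close> pieces by \<open>N k\<close> steps costs at
    most a factor 2.\<close>
  have "1 \<le> N k" using N(2)[OF k(1)] T_pos(1)[of k] by linarith
  then have "real (Suc (N k)) * x \<le> 2 * real (N k) * x"
    using x(1) by (intro mult_right_mono) auto
  then have "T k / 2 \<le> real (N k) * x" using x(3) by simp
  then have "real R * (T k / 2) \<le> real R * (real (N k) * x)"
    by (rule mult_left_mono) simp
  also have "\<dots> \<le> real n * x" using mult_right_mono[OF Rn, of x] x(1) by (simp add: mult.assoc)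
  finally have opt: "real R * T k / 2 \<le> OPT \<sigma>" using \<sigma>(3) by simp
  have pos: "0 < real R * T k / 2" using assms(1) T_pos(1)[of k] by simp
  show ?thesis
  proof (rule that[OF \<sigma>(1)])
    have "real R * real t \<le> real R * real (T k)" using T_pos(2)[of k] by (intro mult_left_mono) auto
    then show "real (R * t) / 2 \<le> OPT \<sigma>" using opt by simp
    \<comment> \<open>The scale cancels: at most \<open>2 * T k\<close> against at least
      \<open>R * T k / 2\<close>.\<close>
    have "ALG alg \<sigma> / OPT \<sigma> \<le> 2 * T k / OPT \<sigma>"
      using \<sigma>(2) a(2) pos opt by (intro divide_right_mono) auto
    also have "\<dots> \<le> 2 * T k / (real R * T k / 2)"
      using pos opt by (intro divide_left_mono) auto
    also have "\<dots> = 4 / real R" using assms(1) T_pos(1)[of k] by (simp add: field_simps)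
    finally show "ALG alg \<sigma> / OPT \<sigma> \<le> 4 / real R" .
  qed
qed

end

section \<open>From bad inputs to the limit inferior\<close>

text \<open>Every eventual property holds for all inputs with optimum above some \<open>K\<close>,
  so one bad input beyond each \<open>K\<close> bounds every infimum in the limit inferior.\<close>

lemma asymptotic_competitive_ratio_le:
  fixes alg :: "'n::finite algorithm"
  assumes "\<And>K. \<exists>\<sigma>\<in>inputs. K \<le> OPT \<sigma> \<and> ALG alg \<sigma> / OPT \<sigma> \<le> c"
  shows "asymptotic_competitive_ratio alg \<le> ereal c"
  unfolding asymptotic_competitive_ratio_def Liminf_def
proof (rule SUP_least)
  fix P :: "'n item list \<Rightarrow> bool"
  assume "P \<in> {P. eventually P (inf (filtercomap OPT at_top) (principal inputs))}"
  then obtain K where K: "\<And>\<sigma>. \<sigma> \<in> inputs \<Longrightarrow> K \<le> OPT \<sigma> \<Longrightarrow> P \<sigma>"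
    by (auto simp: eventually_inf_principal eventually_filtercomap_at_top_linorder)
  obtain \<sigma> where "\<sigma> \<in> inputs" "K \<le> OPT \<sigma>" "ALG alg \<sigma> / OPT \<sigma> \<le> c" using assms by blast
  then show "(INF \<sigma>\<in>Collect P. ereal (ALG alg \<sigma> / OPT \<sigma>)) \<le> ereal c"
    using K by (intro INF_lower2[of \<sigma>]) auto
qed

lemma greedy_type_ratio_le:
  fixes alg :: "2 algorithm"
  assumes "greedy_type alg" "0 < R"
  shows "asymptotic_competitive_ratio alg \<le> ereal (4 / real R)"
proof (rule asymptotic_competitive_ratio_le)
  fix K :: real
  from assms(1) obtain \<phi> where "strict_mono_on {0..} \<phi>"
    "\<And>\<sigma> e j. \<sigma> \<in> inputs \<Longrightarrow> valid_item e \<Longrightarrow> gain \<phi> alg \<sigma> e j \<le> gain \<phi> alg \<sigma> e (alg (\<sigma> @ [e]))"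
    by (auto simp: greedy_type_def)
  then interpret greedy_2 alg \<phi> by unfold_locales
  \<comment> \<open>The factor 2 offsets the half in \<open>bad_input\<close>; the summand 1 ensures
    \<open>t > 0\<close>.\<close>
  obtain t where t: "2 * \<bar>K\<bar> + 1 \<le> real t" using real_arch_simple by blast
  then have "0 < t" by (cases t) auto
  from bad_input[OF assms(2) this] obtain \<sigma> where
    \<sigma>: "\<sigma> \<in> inputs" "real (R * t) / 2 \<le> OPT \<sigma>" "ALG alg \<sigma> / OPT \<sigma> \<le> 4 / real R" .
  have "t \<le> R * t" using assms(2) by simp
  then have "real t \<le> real (R * t)" by (simp only: of_nat_le_iff)
  then have "K \<le> OPT \<sigma>" using t \<sigma>(2) by linarith
  then show "\<exists>\<sigma>\<in>inputs. K \<le> OPT \<sigma> \<and> ALG alg \<sigma> / OPT \<sigma> \<le> 4 / real R" using \<sigma> by blast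
qed

theorem theorem10:
  fixes alg :: "2 algorithm"
  assumes "greedy_type alg"
  shows "asymptotic_competitive_ratio alg \<le> ereal ((3 - sqrt 5) / 2)"
proof -
  \<comment> \<open>As 49/9 exceeds 5, the claimed bound is at least 1/3, which is
    \<open>4 / R\<close> for \<open>R = 12\<close>.\<close>
  have "sqrt 5 \<le> 7 / 3" by (rule real_le_lsqrt) (auto simp: power2_eq_square)
  then have "ereal (4 / real 12) \<le> ereal ((3 - sqrt 5) / 2)" by simp
  with greedy_type_ratio_le[OF assms, of 12] show ?thesis by (meson order_trans zero_less_numeral)
qed

end
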